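(* Let $\mathcal X$ be a complete metric space with intrinsic metric, and write $|xy|$ for the distance between points $x,y\in\mathcal X$. Then $\mathcal X$ is an Alexandrov space with curvature $\ge 0$ if and only if every quadruple of points $p,x,y,z\in\mathcal X$ satisfies the inequality $$|px|^2+|py|^2+|pz|^2\ \ge\ \tfrac13\left(|xy|^2+|yz|^2+|zx|^2\right).$$
   Context: Distances are finite. A metric is intrinsic if the distance between any two points equals the infimum of the lengths of curves joining them (existence of minimizing geodesics is not assumed). Model angle: for points $p,x,y$ of a metric space with $p\ne x$ and $p\ne y$, the model angle $\tilde\angle(p;x,y)\in[0,\pi]$ is the angle at the vertex $\tilde p$ of a triangle $\tilde p\tilde x\tilde y$ in the Euclidean plane with side lengths $|\tilde p\tilde x|=|px|$, $|\tilde p\tilde y|=|py|$, $|\tilde x\tilde y|=|xy|$; equivalently, $\cos\tilde\angle(p;x,y)=\dfrac{|px|^2+|py|^2-|xy|^2}{2|px||py|}$. Alexandrov space with curvature $\ge 0$: a complete metric space $\mathcal X$ with intrinsic metric such that for all points $p,x,y,z\in\mathcal X$ with $p\notin\{x,y,z\}$, $$\tilde\angle(p;x,y)+\tilde\angle(p;y,z)+\tilde\angle(p;z,x)\le 2\pi.$$ *)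

theory Defs
  imports "HOL-Analysis.Analysis"
begin

text \<open>
  Length of a curve \<open>g\<close> parametrized on \<open>[0, 1]\<close>: the supremum, possibly infinite, over all
  partitions \<open>0 = t 0 \<le> t 1 \<le> \<dots> \<le> t n = 1\<close>.
\<close>

definition curve_length :: "'a metric \<Rightarrow> (real \<Rightarrow> 'a) \<Rightarrow> ennreal" where
  "curve_length X g =
     (SUP (n, t) \<in> {(n :: nat, t :: nat \<Rightarrow> real). t 0 = 0 \<and> t n = 1 \<and> mono_on {..n} t}.
        ennreal (\<Sum>i<n. mdist X (g (t i)) (g (t (Suc i)))))"

text \<open>
  The infimum over the empty set is \<open>\<infinity>\<close> in \<^typ>\<open>ennreal\<close>, so an intrinsic metric joins any two
  points by a curve of finite length.
\<close>

definition intrinsic_metric :: "'a metric \<Rightarrow> bool" where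
  "intrinsic_metric X \<longleftrightarrow>
     (\<forall>x \<in> mspace X. \<forall>y \<in> mspace X.
        ennreal (mdist X x y) =
          (INF g \<in> {g. pathin (mtopology_of X) g \<and> g 0 = x \<and> g 1 = y}. curve_length X g))"

text \<open>Only meaningful for \<open>p \<noteq> x\<close> and \<open>p \<noteq> y\<close>.\<close>

definition model_angle :: "'a metric \<Rightarrow> 'a \<Rightarrow> 'a \<Rightarrow> 'a \<Rightarrow> real" where
  "model_angle X p x y =
     arccos (((mdist X p x)\<^sup>2 + (mdist X p y)\<^sup>2 - (mdist X x y)\<^sup>2) / (2 * mdist X p x * mdist X p y))"

text \<open>This is the angle at \<open>P\<close> of any Euclidean triangle \<open>P A B\<close> with the given side lengths.\<close>

lemma model_angle_euclidean:
  fixes P A B :: "real ^ 2"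
  assumes "dist P A = mdist X p x" "dist P B = mdist X p y" "dist A B = mdist X x y"
  shows "model_angle X p x y = arccos ((A - P) \<bullet> (B - P) / (norm (A - P) * norm (B - P)))"
proof -
  have "(dist P A)\<^sup>2 + (dist P B)\<^sup>2 - (dist A B)\<^sup>2 = 2 * ((A - P) \<bullet> (B - P))"
    by (simp add: dist_norm power2_norm_eq_inner inner_diff_left inner_diff_right inner_commute)
  then show ?thesis
    by (simp add: model_angle_def assms[symmetric] dist_norm norm_minus_commute)
qed

definition alexandrov_nonneg_curvature :: "'a metric \<Rightarrow> bool" where
  "alexandrov_nonneg_curvature X \<longleftrightarrow>
     mcomplete_of X \<and> intrinsic_metric X \<and>
     (\<forall>p \<in> mspace X. \<forall>x \<in> mspace X. \<forall>y \<in> mspace X. \<forall>z \<in> mspace X. p \<notin> {x, y, z} \<longrightarrow>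
        model_angle X p x y + model_angle X p y z + model_angle X p z x \<le> 2 * pi)"

end

theory Submission
  imports Defs
begin

text \<open>
  By the law of cosines, the quadruple inequality says that
  \<open>a\<^sup>2 + b\<^sup>2 + c\<^sup>2 + 2 a b cos \<alpha> + 2 b c cos \<beta> + 2 c a cos \<gamma> \<ge> 0\<close>, where \<open>a, b, c\<close> are the distances
  from \<open>p\<close> and \<open>\<alpha>, \<beta>, \<gamma>\<close> are the model angles at \<open>p\<close>. If the angles sum to \<open>2 \<pi>\<close>, this is the squared
  norm of a sum of three planar vectors, and smaller angles only increase it. Conversely, if the
  inequality holds for the given angles and \<^emph>\<open>all\<close> positive \<open>a, b, c\<close>, then the angles sum to at most
  \<open>2 \<pi>\<close>. To vary \<open>a, b, c\<close>, move \<open>x, y, z\<close> towards \<open>p\<close> along almost shortest curves: this cannot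
  decrease the model angles (up to an error) by point-on-side comparison, which is itself a
  consequence of the quadruple inequality.
\<close>

section \<open>Planar trigonometry\<close>

text \<open>The right side is the squared norm of the combination, with coefficients
  \<open>a\<close>, \<open>b\<close>, \<open>c\<close>, of planar unit vectors at polar angles 0,
  \<alpha> and \<alpha> + \<beta>; the left side expands it into inner products.\<close>

lemma planar_triple_sum:
  fixes a b c \<alpha> \<beta> :: real
  shows "a\<^sup>2 + b\<^sup>2 + c\<^sup>2 + 2 * a * b * cos \<alpha> + 2 * b * c * cos \<beta> + 2 * c * a * cos (\<alpha> + \<beta>)
    = (a + b * cos \<alpha> + c * cos (\<alpha> + \<beta>))\<^sup>2 + (b * sin \<alpha> + c * sin (\<alpha> + \<beta>))\<^sup>2"
proof -
  have 1: "cos \<beta> = cos \<alpha> * cos (\<alpha> + \<beta>) + sin \<alpha> * sin (\<alpha> + \<beta>)"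
    using cos_diff[of "\<alpha> + \<beta>" \<alpha>] by (simp add: mult.commute)
  have 2: "b\<^sup>2 = b\<^sup>2 * ((sin \<alpha>)\<^sup>2 + (cos \<alpha>)\<^sup>2)" "c\<^sup>2 = c\<^sup>2 * ((sin (\<alpha> + \<beta>))\<^sup>2 + (cos (\<alpha> + \<beta>))\<^sup>2)"
    by simp_all
  show ?thesis
    unfolding 1 by (subst 2(1), subst 2(2)) (simp only: power2_eq_square, algebra)
qed

text \<open>Cosine decreases on [0, pi] and the weights are nonnegative, so the angles may be
  enlarged until three planar vectors realise them. If \<alpha> + \<beta> is at least pi, \<gamma>
  grows to 2 pi - (\<alpha> + \<beta>).\<close>

lemma weighted_cos_sum_nonneg:
  fixes a b c \<alpha> \<beta> \<gamma> :: real
  assumes abc: "0 \<le> a" "0 \<le> b" "0 \<le> c"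
    and ang: "0 \<le> \<alpha>" "\<alpha> \<le> pi" "0 \<le> \<beta>" "\<beta> \<le> pi" "0 \<le> \<gamma>" "\<gamma> \<le> pi"
    and sum: "\<alpha> + \<beta> + \<gamma> \<le> 2 * pi"
  shows "0 \<le> a\<^sup>2 + b\<^sup>2 + c\<^sup>2 + 2 * a * b * cos \<alpha> + 2 * b * c * cos \<beta> + 2 * c * a * cos \<gamma>"
proof (cases "pi \<le> \<alpha> + \<beta>")
  case True
  have "cos (2 * pi - (\<alpha> + \<beta>)) \<le> cos \<gamma>"
    using True sum ang by (intro cos_monotone_0_pi_le) auto
  then have "cos (\<alpha> + \<beta>) \<le> cos \<gamma>"
    by (simp add: cos_diff)
  then have "2 * c * a * cos (\<alpha> + \<beta>) \<le> 2 * c * a * cos \<gamma>"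
    using abc by (intro mult_left_mono) auto
  moreover have "0 \<le> a\<^sup>2 + b\<^sup>2 + c\<^sup>2 + 2 * a * b * cos \<alpha> + 2 * b * c * cos \<beta> + 2 * c * a * cos (\<alpha> + \<beta>)"
    unfolding planar_triple_sum by simp
  ultimately show ?thesis by linarith
next
  case False
  \<comment> \<open>Now 2 pi - (\<alpha> + \<beta>) exceeds pi, so \<beta> is enlarged to pi -
    \<alpha> and \<gamma> to pi instead: the third vector points opposite to the first.\<close>
  have "cos (pi - \<alpha>) \<le> cos \<beta>"
    using False ang by (intro cos_monotone_0_pi_le) auto
  then have 1: "2 * b * c * (- cos \<alpha>) \<le> 2 * b * c * cos \<beta>"
    using abc by (intro mult_left_mono) (auto simp: cos_diff)
  have 2: "2 * c * a * (-1) \<le> 2 * c * a * cos \<gamma>"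
    using abc by (intro mult_left_mono) auto
  have "0 \<le> (a - c + b * cos \<alpha>)\<^sup>2 + (b * sin \<alpha>)\<^sup>2"
    by simp
  also have "\<dots> = (a - c)\<^sup>2 + 2 * (a - c) * b * cos \<alpha> + b\<^sup>2 * ((sin \<alpha>)\<^sup>2 + (cos \<alpha>)\<^sup>2)"
    by algebra
  also have "\<dots> = a\<^sup>2 + b\<^sup>2 + c\<^sup>2 + 2 * a * b * cos \<alpha> + 2 * b * c * (- cos \<alpha>) + 2 * c * a * (-1)"
    by (simp add: algebra_simps power2_eq_square)
  finally show ?thesis using 1 2 by linarith
qed

text \<open>If the sum exceeded 2 pi, scaling all angles by a common factor below 1 would make it
  exactly 2 pi. The form then vanishes at suitable positive weights, and since scaling strictly
  raises every cosine, it is negative there for the original angles.\<close>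

lemma angle_sum_le_2pi_if_copositive:
  fixes \<alpha> \<beta> \<gamma> :: real
  assumes ang: "0 \<le> \<alpha>" "\<alpha> \<le> pi" "0 \<le> \<beta>" "\<beta> \<le> pi" "0 \<le> \<gamma>" "\<gamma> \<le> pi"
    and copos: "\<And>a b c. 0 < a \<Longrightarrow> 0 < b \<Longrightarrow> 0 < c \<Longrightarrow>
      0 \<le> a\<^sup>2 + b\<^sup>2 + c\<^sup>2 + 2 * a * b * cos \<alpha> + 2 * b * c * cos \<beta> + 2 * c * a * cos \<gamma>"
  shows "\<alpha> + \<beta> + \<gamma> \<le> 2 * pi"
proof (rule ccontr)
  assume "\<not> ?thesis"
  then have S: "2 * pi < \<alpha> + \<beta> + \<gamma>" by simp
  then have pos: "0 < \<alpha>" "0 < \<beta>" "0 < \<gamma>" using ang by auto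
  define k where "k = 2 * pi / (\<alpha> + \<beta> + \<gamma>)"
  have k: "0 < k" "k < 1" using S pos by (auto simp: k_def)
  have less: "k * \<theta> < \<theta>" "0 < k * \<theta>" if "0 < \<theta>" for \<theta>
    using k that by auto
  have "k * (\<alpha> + \<beta> + \<gamma>) = 2 * pi"
    using pos by (simp add: k_def)
  then have \<gamma>: "k * \<gamma> = 2 * pi - (k * \<alpha> + k * \<beta>)"
    by (simp add: algebra_simps)
  \<comment> \<open>Unit vectors at mutual angles \<open>k * \<alpha>\<close>, \<open>k * \<beta>\<close>, \<open>k * \<gamma>\<close>, which sum to \<open>2 * pi\<close>, balance with these
    weights by the law of sines.\<close>
  define a where "a = sin (k * \<beta>)"
  define b where "b = sin (k * \<gamma>)"
  define c where "c = sin (k * \<alpha>)"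
  have abc: "0 < a" "0 < b" "0 < c"
    unfolding a_def b_def c_def using less[OF pos(1)] less[OF pos(2)] less[OF pos(3)] ang
    by (auto intro!: sin_gt_zero)
  have cos_less: "cos \<theta> < cos (k * \<theta>)" if "0 < \<theta>" "\<theta> \<le> pi" for \<theta>
    using less[OF that(1)] that by (intro cos_monotone_0_pi) auto
  have cos\<gamma>: "cos (k * \<gamma>) = cos (k * \<alpha> + k * \<beta>)" and b: "b = - sin (k * \<alpha> + k * \<beta>)"
    unfolding b_def \<gamma> by (simp_all add: cos_diff sin_diff)
  have "a + b * cos (k * \<alpha>) + c * cos (k * \<alpha> + k * \<beta>) = 0"
  proof -
    have "a = sin ((k * \<alpha> + k * \<beta>) - k * \<alpha>)" by (simp add: a_def)
    then show ?thesis unfolding sin_diff by (simp add: b c_def)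
  qed
  moreover have "b * sin (k * \<alpha>) + c * sin (k * \<alpha> + k * \<beta>) = 0"
    by (simp add: b c_def)
  ultimately have "a\<^sup>2 + b\<^sup>2 + c\<^sup>2 + 2 * a * b * cos (k * \<alpha>) + 2 * b * c * cos (k * \<beta>)
      + 2 * c * a * cos (k * \<gamma>) = 0"
    unfolding cos\<gamma> planar_triple_sum by simp
  moreover have "2 * a * b * cos \<alpha> < 2 * a * b * cos (k * \<alpha>)"
    "2 * b * c * cos \<beta> < 2 * b * c * cos (k * \<beta>)"
    "2 * c * a * cos \<gamma> < 2 * c * a * cos (k * \<gamma>)"
    using abc pos ang by (auto intro!: mult_strict_left_mono cos_less)
  ultimately show False using copos[OF abc] by linarith
qed

section \<open>The quadruple inequality in length spaces\<close>

text \<open>Uniform continuity of squaring on [0, \<open>l\<close>]; it turns the length error of an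
  almost shortest curve into an error of squared distances.\<close>

lemma small_square_increment:
  fixes l \<delta> :: real
  assumes "0 \<le> l" "0 < \<delta>"
  obtains e where "0 < e" "e \<le> \<delta>" "\<And>a. 0 \<le> a \<Longrightarrow> a \<le> l \<Longrightarrow> (a + e)\<^sup>2 \<le> a\<^sup>2 + \<delta>"
proof
  define e where "e = min 1 (\<delta> / (2 * l + 1))"
  show e: "0 < e" using assms by (simp add: e_def)
  have "e * (2 * l + 1) \<le> \<delta> / (2 * l + 1) * (2 * l + 1)"
    unfolding e_def using assms by (intro mult_right_mono) auto
  also have "\<dots> = \<delta>"
    using assms by simp
  finally have e2: "e * (2 * l + 1) \<le> \<delta>" .
  have "e * 1 \<le> e * (2 * l + 1)"
    using e assms by (intro mult_left_mono) auto
  then show "e \<le> \<delta>"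
    using e2 by linarith
  show "(a + e)\<^sup>2 \<le> a\<^sup>2 + \<delta>" if "0 \<le> a" "a \<le> l" for a
  proof -
    have "e \<le> 1" by (simp add: e_def)
    then have "(a + e)\<^sup>2 \<le> a\<^sup>2 + e * (2 * a + 1)"
      using e mult_left_mono[of e 1 e] by (simp add: power2_eq_square algebra_simps)
    also have "\<dots> \<le> a\<^sup>2 + e * (2 * l + 1)"
      using e that by (intro add_left_mono mult_left_mono) auto
    finally show ?thesis using e2 by linarith
  qed
qed

text \<open>\<open>approx_point\<close> stands in for minimizing geodesics: the distance from
  \<open>x\<close> is exact and the whole error falls on the side of \<open>y\<close>.\<close>

locale quadruple_length_space = Metric_space M d for M :: "'a set" and d +
  assumes approx_point: "\<And>x y s e. x \<in> M \<Longrightarrow> y \<in> M \<Longrightarrow> 0 \<le> s \<Longrightarrow> s \<le> 1 \<Longrightarrow> 0 < e \<Longrightarrow>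
      \<exists>m\<in>M. d x m = s * d x y \<and> d m y \<le> (1 - s) * d x y + e"
    and quadruple: "\<And>p x y z. p \<in> M \<Longrightarrow> x \<in> M \<Longrightarrow> y \<in> M \<Longrightarrow> z \<in> M \<Longrightarrow>
      (d x y)\<^sup>2 + (d y z)\<^sup>2 + (d z x)\<^sup>2 \<le> 3 * (d p x)\<^sup>2 + 3 * (d p y)\<^sup>2 + 3 * (d p z)\<^sup>2"
begin

text \<open>
  In the Euclidean plane the quadruple inequality is an equality at the centroid of \<open>x y z\<close>.
  Replacing \<open>z\<close> by the point one third of the way from \<open>m\<close> to \<open>z\<close> therefore divides the defect
  of the midpoint comparison by at most 3, whereas the bound in the base case is quadratic in the
  distance from \<open>m\<close>.
\<close>

lemma midpoint_defect:
  assumes "x \<in> M" "y \<in> M" "m \<in> M" "z \<in> M"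
  shows "(d x z)\<^sup>2 / 2 + (d y z)\<^sup>2 / 2 - (d x y)\<^sup>2 / 4 - (d m z)\<^sup>2
    \<le> (d m z)\<^sup>2 / (2 * 3 ^ n) + 3 ^ n * (3 / 2 * (d m x)\<^sup>2 + 3 / 2 * (d m y)\<^sup>2 - 3 / 4 * (d x y)\<^sup>2)"
  using \<open>z \<in> M\<close>
proof (induction n arbitrary: z)
  case 0
  then show ?case
    using quadruple[OF assms(3,1,2) 0] unfolding commute[of z x] power_0 mult_1_right mult_1_left
    by linarith
next
  case (Suc n)
  \<comment> \<open>\<open>?E\<close> vanishes when \<open>m\<close> is an exact midpoint of
    \<open>x\<close> and \<open>y\<close>, so it measures how far \<open>m\<close> is from being
    one.\<close>
  let ?E = "3 / 2 * (d m x)\<^sup>2 + 3 / 2 * (d m y)\<^sup>2 - 3 / 4 * (d x y)\<^sup>2"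
  let ?D = "\<lambda>z. (d x z)\<^sup>2 / 2 + (d y z)\<^sup>2 / 2 - (d x y)\<^sup>2 / 4 - (d m z)\<^sup>2"
  show ?case
  proof (rule field_le_epsilon)
    fix \<delta> :: real assume "0 < \<delta>"
    obtain e where e: "0 < e"
      "\<And>a. 0 \<le> a \<Longrightarrow> a \<le> 2 / 3 * d m z \<Longrightarrow> (a + e)\<^sup>2 \<le> a\<^sup>2 + \<delta> / 2"
      by (rule small_square_increment[of "2 / 3 * d m z" "\<delta> / 2"]) (use \<open>0 < \<delta>\<close> in simp_all)
    obtain p where p: "p \<in> M" "d m p = 1 / 3 * d m z" "d p z \<le> (1 - 1 / 3) * d m z + e"
      using approx_point[of m z "1/3" e] assms Suc.prems e(1) by auto
    have "(d p z)\<^sup>2 \<le> (2 / 3 * d m z + e)\<^sup>2"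
      using p by (intro power_mono) auto
    also have "\<dots> \<le> (2 / 3 * d m z)\<^sup>2 + \<delta> / 2"
      by (intro e(2)) auto
    finally have pz: "(d p z)\<^sup>2 \<le> 4 / 9 * (d m z)\<^sup>2 + \<delta> / 2"
      by (simp add: power2_eq_square)
    have mp: "(d m p)\<^sup>2 = (d m z)\<^sup>2 / 9"
      by (simp add: p power2_eq_square)
    \<comment> \<open>The ratio 1/3 makes 3 |mp|^2 + 3/2 |pz|^2 equal to |mz|^2 up to the error, so
      that only three times the defect at \<open>p\<close> remains.\<close>
    have "?D z \<le> 3 * ?D p + \<delta>"
      using quadruple[OF p(1) assms(1,2) Suc.prems] pz mp \<open>0 < \<delta>\<close>
      unfolding commute[of z x] commute[of p x] commute[of p y] ring_distribs by linarith
    also have "3 * ?D p \<le> 3 * ((d m p)\<^sup>2 / (2 * 3 ^ n) + 3 ^ n * ?E)"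
      by (intro mult_left_mono Suc.IH p) simp
    also have "\<dots> = (d m z)\<^sup>2 / (2 * 3 ^ Suc n) + 3 ^ Suc n * ?E"
      unfolding mp by (simp add: field_simps)
    finally show "?D z \<le> (d m z)\<^sup>2 / (2 * 3 ^ Suc n) + 3 ^ Suc n * ?E + \<delta>"
      by simp
  qed
qed

text \<open>The order of choices matters: \<open>n\<close> first makes the quadratic term of
  \<open>midpoint_defect\<close> small for all \<open>z\<close> within \<open>R\<close> of
  \<open>x\<close>, and only then is \<open>m\<close> taken so close to a midpoint that its error
  survives the factor 3^n.\<close>

lemma approx_midpoint:
  assumes "x \<in> M" "y \<in> M" "0 < \<delta>"
  obtains m where "m \<in> M" "d x m \<le> d x y / 2 + \<delta>" "d m y \<le> d x y / 2 + \<delta>"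
    "\<And>z. z \<in> M \<Longrightarrow> d x z \<le> R \<Longrightarrow>
       (d x z)\<^sup>2 / 2 + (d y z)\<^sup>2 / 2 - (d x y)\<^sup>2 / 4 - \<delta> \<le> (d m z)\<^sup>2"
proof -
  define T where "T = (d x y + \<bar>R\<bar>)\<^sup>2"
  obtain n where n: "T / \<delta> < 3 ^ n"
    using real_arch_pow[of 3 "T / \<delta>"] by auto
  have T: "T / (2 * 3 ^ n) \<le> \<delta> / 2"
    using n \<open>0 < \<delta>\<close> by (simp add: field_simps)
  obtain e where e: "0 < e" "e \<le> \<delta> / (3 * 3 ^ n)"
    "\<And>a. 0 \<le> a \<Longrightarrow> a \<le> d x y / 2 \<Longrightarrow> (a + e)\<^sup>2 \<le> a\<^sup>2 + \<delta> / (3 * 3 ^ n)"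
    using small_square_increment[of "d x y / 2" "\<delta> / (3 * 3 ^ n)"] \<open>0 < \<delta>\<close> by auto
  obtain m where m: "m \<in> M" "d x m = 1 / 2 * d x y" "d m y \<le> (1 - 1 / 2) * d x y + e"
    using approx_point[of x y "1/2" e] assms e(1) by auto
  have "(1 :: real) \<le> 3 ^ n" by simp
  then have "\<delta> * 1 \<le> \<delta> * (3 * 3 ^ n)"
    using \<open>0 < \<delta>\<close> by (intro mult_left_mono) (linarith, simp)
  then have "\<delta> / (3 * 3 ^ n) \<le> \<delta>"
    by (simp add: divide_le_eq)
  with e(2) have e\<delta>: "e \<le> \<delta>" by linarith
  have "(d m y)\<^sup>2 \<le> (d x y / 2 + e)\<^sup>2"
    using m by (intro power_mono) auto
  also have "\<dots> \<le> (d x y / 2)\<^sup>2 + \<delta> / (3 * 3 ^ n)"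
    by (intro e) auto
  finally have my: "(d m y)\<^sup>2 \<le> (d x y)\<^sup>2 / 4 + \<delta> / (3 * 3 ^ n)"
    by (simp add: power2_eq_square)
  have mx: "(d m x)\<^sup>2 = (d x y)\<^sup>2 / 4"
    unfolding commute[of m x] m(2) by (simp add: power2_eq_square)
  have "3 / 2 * (d m x)\<^sup>2 + 3 / 2 * (d m y)\<^sup>2 - 3 / 4 * (d x y)\<^sup>2 \<le> 3 / 2 * (\<delta> / (3 * 3 ^ n))"
    using mx my by linarith
  then have E: "3 ^ n * (3 / 2 * (d m x)\<^sup>2 + 3 / 2 * (d m y)\<^sup>2 - 3 / 4 * (d x y)\<^sup>2) \<le> \<delta> / 2"
    by (simp add: field_simps)
  show thesis
  proof (rule that[OF m(1)])
    show "d x m \<le> d x y / 2 + \<delta>" "d m y \<le> d x y / 2 + \<delta>"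
      using m e\<delta> \<open>0 < \<delta>\<close> by auto
    fix z assume z: "z \<in> M" "d x z \<le> R"
    have "d m z \<le> d x y + \<bar>R\<bar>"
      using triangle[OF m(1) assms(1) z(1)] m(2) z(2) nonneg[of x y] abs_ge_self[of R]
      unfolding commute[of m x] by linarith
    then have "(d m z)\<^sup>2 \<le> T"
      unfolding T_def by (intro power_mono) auto
    then have "(d m z)\<^sup>2 / (2 * 3 ^ n) \<le> T / (2 * 3 ^ n)"
      by (intro divide_right_mono) auto
    then show "(d x z)\<^sup>2 / 2 + (d y z)\<^sup>2 / 2 - (d x y)\<^sup>2 / 4 - \<delta> \<le> (d m z)\<^sup>2"
      using midpoint_defect[OF assms(1,2) m(1) z(1), of n] T E by linarith
  qed
qed

text \<open>
  The point of ratio \<open>s \<le> 1/2\<close> is the midpoint of \<open>x\<close> and the point of ratio \<open>2 * s\<close>, and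
  symmetrically at the other end; either way, passing to the midpoint halves the defect.
\<close>

lemma approx_point_on_side_aux:
  assumes x: "x \<in> M" and y: "y \<in> M"
  shows "0 \<le> s \<Longrightarrow> s \<le> 1 \<Longrightarrow> 0 < \<delta> \<Longrightarrow>
    \<exists>m\<in>M. d x m \<le> s * d x y + \<delta> \<and> d m y \<le> (1 - s) * d x y + \<delta> \<and>
      (\<forall>z\<in>M. d x z \<le> R \<longrightarrow>
        (1 - s) * (d x z)\<^sup>2 + s * (d y z)\<^sup>2 - s * (1 - s) * (d x y)\<^sup>2
          - ((d x z)\<^sup>2 + (d y z)\<^sup>2) / 2 ^ n - \<delta> \<le> (d m z)\<^sup>2)"
proof (induction n arbitrary: s \<delta>)
  case 0
  obtain m where m: "m \<in> M" "d x m = s * d x y" "d m y \<le> (1 - s) * d x y + \<delta>"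
    using approx_point[OF x y 0] by auto
  \<comment> \<open>For \<open>n\<close> = 0 the permitted defect outweighs the positive terms, so
    the left side is negative and any point of ratio \<open>s\<close> will do.\<close>
  have "(1 - s) * (d x z)\<^sup>2 + s * (d y z)\<^sup>2 - s * (1 - s) * (d x y)\<^sup>2
      - ((d x z)\<^sup>2 + (d y z)\<^sup>2) / 2 ^ 0 - \<delta> \<le> (d m z)\<^sup>2" for z
  proof -
    have "(1 - s) * (d x z)\<^sup>2 \<le> 1 * (d x z)\<^sup>2" "s * (d y z)\<^sup>2 \<le> 1 * (d y z)\<^sup>2"
      "0 \<le> s * ((1 - s) * (d x y)\<^sup>2)"
      using 0 by (auto intro: mult_left_le_one_le)
    then show ?thesis
      using \<open>0 < \<delta>\<close> zero_le_power2[of "d m z"] unfolding power_0 div_by_1 mult.assoc by linarith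
  qed
  then show ?case using m 0 by (intro bexI[of _ m]) auto
next
  case (Suc n)
  obtain e where e: "0 < e" "e \<le> \<delta> / 2"
    "\<And>a. 0 \<le> a \<Longrightarrow> a \<le> d x y \<Longrightarrow> (a + e)\<^sup>2 \<le> a\<^sup>2 + \<delta> / 2"
    using small_square_increment[of "d x y" "\<delta> / 2"] Suc.prems by auto
  \<comment> \<open>Used with \<open>t\<close> the distance from \<open>w\<close> to the nearer end
    and \<open>r\<close> the target ratio from that end: \<open>w\<close> lies at about twice the
    target distance.\<close>
  have sq: "t\<^sup>2 / 4 \<le> r\<^sup>2 * (d x y)\<^sup>2 + \<delta> / 8"
    if "t \<le> 2 * r * d x y + e" "0 \<le> t" "0 \<le> r" "2 * r \<le> 1" for t r
  proof -
    have "t\<^sup>2 \<le> (2 * r * d x y + e)\<^sup>2"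
      using that by (intro power_mono) auto
    also have "\<dots> \<le> (2 * r * d x y)\<^sup>2 + \<delta> / 2"
      using that mult_right_mono[of "2 * r" 1 "d x y"] by (intro e) auto
    finally show ?thesis by (simp add: power_mult_distrib)
  qed
  show ?case
  proof (cases "s \<le> 1 / 2")
    case True
    obtain w where w: "w \<in> M" "d x w \<le> 2 * s * d x y + e" "d w y \<le> (1 - 2 * s) * d x y + e"
      "\<And>z. z \<in> M \<Longrightarrow> d x z \<le> R \<Longrightarrow>
        (1 - 2 * s) * (d x z)\<^sup>2 + 2 * s * (d y z)\<^sup>2 - 2 * s * (1 - 2 * s) * (d x y)\<^sup>2
          - ((d x z)\<^sup>2 + (d y z)\<^sup>2) / 2 ^ n - e \<le> (d w z)\<^sup>2"
      using Suc.IH[of "2 * s" e] Suc.prems True e(1) by auto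
    obtain m where m: "m \<in> M" "d x m \<le> d x w / 2 + \<delta> / 8" "d m w \<le> d x w / 2 + \<delta> / 8"
      "\<And>z. z \<in> M \<Longrightarrow> d x z \<le> R \<Longrightarrow>
         (d x z)\<^sup>2 / 2 + (d w z)\<^sup>2 / 2 - (d x w)\<^sup>2 / 4 - \<delta> / 8 \<le> (d m z)\<^sup>2"
      using approx_midpoint[OF x w(1), of "\<delta> / 8" R] Suc.prems by auto
    have xw: "(d x w)\<^sup>2 / 4 \<le> s\<^sup>2 * (d x y)\<^sup>2 + \<delta> / 8"
      using sq[of "d x w" s] w Suc.prems True by auto
    show ?thesis
    proof (intro bexI[of _ m] conjI ballI impI)
      show "d x m \<le> s * d x y + \<delta>"
        using m(2) w(2) e(2) Suc.prems(3) by simp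
      show "d m y \<le> (1 - s) * d x y + \<delta>"
        using triangle[OF m(1) w(1) y] m(3) w(2,3) e(2) Suc.prems(3) by (simp add: algebra_simps)
      fix z assume z: "z \<in> M" "d x z \<le> R"
      define Q where "Q = (1 - 2 * s) * (d x z)\<^sup>2 + 2 * s * (d y z)\<^sup>2
        - 2 * s * (1 - 2 * s) * (d x y)\<^sup>2 - ((d x z)\<^sup>2 + (d y z)\<^sup>2) / 2 ^ n"
      have "(1 - s) * (d x z)\<^sup>2 + s * (d y z)\<^sup>2 - s * (1 - s) * (d x y)\<^sup>2
          - ((d x z)\<^sup>2 + (d y z)\<^sup>2) / 2 ^ Suc n
        = (d x z)\<^sup>2 / 2 + Q / 2 - s\<^sup>2 * (d x y)\<^sup>2"
        unfolding Q_def by (simp add: field_simps power2_eq_square)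
      moreover have "Q - e \<le> (d w z)\<^sup>2"
        unfolding Q_def by (rule w(4)[OF z])
      ultimately show "(1 - s) * (d x z)\<^sup>2 + s * (d y z)\<^sup>2 - s * (1 - s) * (d x y)\<^sup>2
          - ((d x z)\<^sup>2 + (d y z)\<^sup>2) / 2 ^ Suc n - \<delta> \<le> (d m z)\<^sup>2"
        using m(4)[OF z] xw e(2) Suc.prems by linarith
    qed (rule m)
  next
    case False
    obtain w where w: "w \<in> M" "d x w \<le> (2 * s - 1) * d x y + e" "d w y \<le> 2 * (1 - s) * d x y + e"
      "\<And>z. z \<in> M \<Longrightarrow> d x z \<le> R \<Longrightarrow>
        2 * (1 - s) * (d x z)\<^sup>2 + (2 * s - 1) * (d y z)\<^sup>2 - (2 * s - 1) * (2 * (1 - s)) * (d x y)\<^sup>2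
          - ((d x z)\<^sup>2 + (d y z)\<^sup>2) / 2 ^ n - e \<le> (d w z)\<^sup>2"
    proof -
      have "1 - (2 * s - 1) = 2 * (1 - s)" by simp
      then show thesis
        using Suc.IH[of "2 * s - 1" e] Suc.prems False e(1) that by auto
    qed
    \<comment> \<open>The midpoint comparison is now based at \<open>y\<close>; points within
      \<open>R\<close> of \<open>x\<close> lie within \<open>d x y + R\<close> of
      \<open>y\<close>.\<close>
    obtain m where m: "m \<in> M" "d y m \<le> d y w / 2 + \<delta> / 8" "d m w \<le> d y w / 2 + \<delta> / 8"
      "\<And>z. z \<in> M \<Longrightarrow> d y z \<le> d x y + R \<Longrightarrow>
         (d y z)\<^sup>2 / 2 + (d w z)\<^sup>2 / 2 - (d y w)\<^sup>2 / 4 - \<delta> / 8 \<le> (d m z)\<^sup>2"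
      using approx_midpoint[OF y w(1), of "\<delta> / 8" "d x y + R"] Suc.prems by auto
    have yw: "(d y w)\<^sup>2 / 4 \<le> (1 - s)\<^sup>2 * (d x y)\<^sup>2 + \<delta> / 8"
      using sq[of "d y w" "1 - s"] w Suc.prems False by (auto simp: commute)
    show ?thesis
    proof (intro bexI[of _ m] conjI ballI impI)
      show "d m y \<le> (1 - s) * d x y + \<delta>"
        using m(2) w(3) e(2) Suc.prems(3) unfolding commute[of m y] commute[of y w]
        by (simp add: algebra_simps)
      show "d x m \<le> s * d x y + \<delta>"
        using triangle[OF x w(1) m(1)] m(3) w(2,3) e(2) Suc.prems(3)
        unfolding commute[of w m] commute[of y w] by (simp add: algebra_simps)
      fix z assume z: "z \<in> M" "d x z \<le> R"
      have yz: "d y z \<le> d x y + R"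
        using triangle[OF y x z(1)] z by (simp add: commute)
      define Q where "Q = 2 * (1 - s) * (d x z)\<^sup>2 + (2 * s - 1) * (d y z)\<^sup>2
        - (2 * s - 1) * (2 * (1 - s)) * (d x y)\<^sup>2 - ((d x z)\<^sup>2 + (d y z)\<^sup>2) / 2 ^ n"
      have "(1 - s) * (d x z)\<^sup>2 + s * (d y z)\<^sup>2 - s * (1 - s) * (d x y)\<^sup>2
          - ((d x z)\<^sup>2 + (d y z)\<^sup>2) / 2 ^ Suc n
        = (d y z)\<^sup>2 / 2 + Q / 2 - (1 - s)\<^sup>2 * (d x y)\<^sup>2"
        unfolding Q_def by (simp add: field_simps power2_eq_square)
      moreover have "Q - e \<le> (d w z)\<^sup>2"
        unfolding Q_def by (rule w(4)[OF z])
      ultimately show "(1 - s) * (d x z)\<^sup>2 + s * (d y z)\<^sup>2 - s * (1 - s) * (d x y)\<^sup>2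
          - ((d x z)\<^sup>2 + (d y z)\<^sup>2) / 2 ^ Suc n - \<delta> \<le> (d m z)\<^sup>2"
        using m(4)[OF z(1) yz] yw e(2) Suc.prems by linarith
    qed (rule m)
  qed
qed

text \<open>By Stewart's theorem the main terms give the squared distance from \<open>z\<close> to
  the point of ratio \<open>s\<close> on \<open>x y\<close> in the Euclidean plane. One
  \<open>m\<close> must serve all \<open>z\<close> in a ball, because it is later compared with
  points chosen independently of it.\<close>

lemma approx_point_on_side:
  assumes x: "x \<in> M" and y: "y \<in> M" and s: "0 \<le> s" "s \<le> 1" and \<delta>: "0 < \<delta>"
  obtains m where "m \<in> M" "(d x m)\<^sup>2 \<le> s\<^sup>2 * (d x y)\<^sup>2 + \<delta>" "d x m \<le> d x y + \<delta>"
    "\<forall>z\<in>M. d x z \<le> R \<longrightarrow>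
       (1 - s) * (d x z)\<^sup>2 + s * (d y z)\<^sup>2 - s * (1 - s) * (d x y)\<^sup>2 - \<delta> \<le> (d m z)\<^sup>2"
proof -
  define C where "C = R\<^sup>2 + (d x y + R)\<^sup>2"
  obtain n where n: "C / (\<delta> / 2) < 2 ^ n"
    using real_arch_pow[of 2 "C / (\<delta> / 2)"] by auto
  have C: "C / 2 ^ n \<le> \<delta> / 2"
    using n \<delta> by (simp add: field_simps)
  obtain e where e: "0 < e" "e \<le> \<delta> / 2"
    "\<And>a. 0 \<le> a \<Longrightarrow> a \<le> d x y \<Longrightarrow> (a + e)\<^sup>2 \<le> a\<^sup>2 + \<delta> / 2"
    using small_square_increment[of "d x y" "\<delta> / 2"] \<delta> by auto
  obtain m where m: "m \<in> M" "d x m \<le> s * d x y + e"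
      "\<And>z. z \<in> M \<Longrightarrow> d x z \<le> R \<Longrightarrow>
        (1 - s) * (d x z)\<^sup>2 + s * (d y z)\<^sup>2 - s * (1 - s) * (d x y)\<^sup>2
          - ((d x z)\<^sup>2 + (d y z)\<^sup>2) / 2 ^ n - e \<le> (d m z)\<^sup>2"
    using approx_point_on_side_aux[OF x y s e(1), of R n] by blast
  have sl: "s * d x y \<le> d x y"
    using s mult_right_mono[of s 1 "d x y"] by simp
  have "(d x m)\<^sup>2 \<le> (s * d x y + e)\<^sup>2"
    using m by (intro power_mono) auto
  also have "\<dots> \<le> (s * d x y)\<^sup>2 + \<delta> / 2"
    using s sl by (intro e) auto
  finally have "(d x m)\<^sup>2 \<le> s\<^sup>2 * (d x y)\<^sup>2 + \<delta>"
    using \<delta> by (simp add: power_mult_distrib)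
  moreover have "d x m \<le> d x y + \<delta>"
    using m(2) sl e \<delta> by linarith
  moreover have "(1 - s) * (d x z)\<^sup>2 + s * (d y z)\<^sup>2 - s * (1 - s) * (d x y)\<^sup>2 - \<delta> \<le> (d m z)\<^sup>2"
    if z: "z \<in> M" "d x z \<le> R" for z
  proof -
    have "d y z \<le> d x y + R"
      using triangle[OF y x z(1)] z by (simp add: commute)
    then have "(d x z)\<^sup>2 + (d y z)\<^sup>2 \<le> C"
      unfolding C_def using z by (intro add_mono power_mono) auto
    then have "((d x z)\<^sup>2 + (d y z)\<^sup>2) / 2 ^ n \<le> C / 2 ^ n"
      by (intro divide_right_mono) auto
    then show ?thesis using m(3)[OF z] C e by linarith
  qed
  ultimately show thesis by (intro that[OF m(1)]) auto
qed

text \<open>Comparison is applied twice: \<open>x'\<close> against \<open>y'\<close>, and then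
  \<open>y'\<close> against both \<open>p\<close> and \<open>x\<close>. The result is the law of
  cosines for sides \<open>s\<close> |px| and \<open>t\<close> |py| enclosing the model angle at
  \<open>p\<close>.\<close>

lemma shrunk_pair_distance:
  assumes pts: "p \<in> M" "x \<in> M" "y \<in> M" "x' \<in> M" "y' \<in> M"
    and s: "0 \<le> s" "s \<le> 1" and t: "0 \<le> t" "t \<le> 1" and "0 < \<delta>"
    and R: "d p x \<le> R" "d p y' \<le> R"
    and x': "\<forall>z\<in>M. d p z \<le> R \<longrightarrow>
       (1 - s) * (d p z)\<^sup>2 + s * (d x z)\<^sup>2 - s * (1 - s) * (d p x)\<^sup>2 - \<delta> \<le> (d x' z)\<^sup>2"
    and y': "\<forall>z\<in>M. d p z \<le> R \<longrightarrow>
       (1 - t) * (d p z)\<^sup>2 + t * (d y z)\<^sup>2 - t * (1 - t) * (d p y)\<^sup>2 - \<delta> \<le> (d y' z)\<^sup>2"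
  shows "s\<^sup>2 * (d p x)\<^sup>2 + t\<^sup>2 * (d p y)\<^sup>2 - s * t * ((d p x)\<^sup>2 + (d p y)\<^sup>2 - (d x y)\<^sup>2) - 3 * \<delta>
    \<le> (d x' y')\<^sup>2"
proof -
  have "0 \<le> R" using R(1) nonneg[of p x] by linarith
  then have "t * (d p y)\<^sup>2 - t * (1 - t) * (d p y)\<^sup>2 - \<delta> \<le> (d p y')\<^sup>2"
    using y' pts by (force simp: commute)
  then have "(1 - s) * (t * (d p y)\<^sup>2 - t * (1 - t) * (d p y)\<^sup>2 - \<delta>) \<le> (1 - s) * (d p y')\<^sup>2"
    using s by (intro mult_left_mono) auto
  moreover have "s * ((1 - t) * (d p x)\<^sup>2 + t * (d x y)\<^sup>2 - t * (1 - t) * (d p y)\<^sup>2 - \<delta>)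
      \<le> s * (d x y')\<^sup>2"
    using y' pts(2) R(1) s by (intro mult_left_mono) (auto simp: commute)
  moreover have "(1 - s) * (d p y')\<^sup>2 + s * (d x y')\<^sup>2 - s * (1 - s) * (d p x)\<^sup>2 - \<delta> \<le> (d x' y')\<^sup>2"
    using x' pts(5) R(2) by blast
  ultimately have "(1 - s) * (t * (d p y)\<^sup>2 - t * (1 - t) * (d p y)\<^sup>2 - \<delta>)
      + s * ((1 - t) * (d p x)\<^sup>2 + t * (d x y)\<^sup>2 - t * (1 - t) * (d p y)\<^sup>2 - \<delta>)
      - s * (1 - s) * (d p x)\<^sup>2 - \<delta> \<le> (d x' y')\<^sup>2"
    by linarith
  then show ?thesis
    using \<open>0 < \<delta>\<close> by (simp add: algebra_simps power2_eq_square)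
qed

text \<open>
  The quadruple inequality for points on the sides \<open>p x\<close>, \<open>p y\<close>, \<open>p z\<close> at ratios \<open>r\<close>, \<open>s\<close>, \<open>t\<close>
  from \<open>p\<close>; by point-on-side comparison their mutual distances are at least the Euclidean ones.
\<close>

lemma weighted_quadruple_le_1:
  assumes pts: "p \<in> M" "x \<in> M" "y \<in> M" "z \<in> M"
    and r: "0 \<le> r" "r \<le> 1" and s: "0 \<le> s" "s \<le> 1" and t: "0 \<le> t" "t \<le> 1"
  shows "0 \<le> r\<^sup>2 * (d p x)\<^sup>2 + s\<^sup>2 * (d p y)\<^sup>2 + t\<^sup>2 * (d p z)\<^sup>2
    + r * s * ((d p x)\<^sup>2 + (d p y)\<^sup>2 - (d x y)\<^sup>2) + s * t * ((d p y)\<^sup>2 + (d p z)\<^sup>2 - (d y z)\<^sup>2)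
    + t * r * ((d p z)\<^sup>2 + (d p x)\<^sup>2 - (d z x)\<^sup>2)"
proof (rule field_le_epsilon)
  fix \<epsilon> :: real assume "0 < \<epsilon>"
  \<comment> \<open>The three pairs lose 3 \<delta> each, and the three squared radii, weighted by 3
    in the quadruple inequality, add 9 \<delta> more.\<close>
  define \<delta> where "\<delta> = \<epsilon> / 18"
  have \<delta>: "0 < \<delta>" using \<open>0 < \<epsilon>\<close> by (simp add: \<delta>_def)
  \<comment> \<open>The extra \<delta> keeps the shrunk points, which may overshoot, inside the ball
    where comparison holds.\<close>
  define R where "R = d p x + d p y + d p z + \<delta>"
  have R: "d p x \<le> R" "d p y \<le> R" "d p z \<le> R" "d p x + \<delta> \<le> R" "d p y + \<delta> \<le> R" "d p z + \<delta> \<le> R"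
    using \<delta> nonneg[of p x] nonneg[of p y] nonneg[of p z] unfolding R_def by linarith+
  obtain x' where x': "x' \<in> M" "(d p x')\<^sup>2 \<le> r\<^sup>2 * (d p x)\<^sup>2 + \<delta>" "d p x' \<le> d p x + \<delta>"
    "\<forall>w\<in>M. d p w \<le> R \<longrightarrow>
       (1 - r) * (d p w)\<^sup>2 + r * (d x w)\<^sup>2 - r * (1 - r) * (d p x)\<^sup>2 - \<delta> \<le> (d x' w)\<^sup>2"
    using approx_point_on_side[OF pts(1,2) r \<delta>] by metis
  obtain y' where y': "y' \<in> M" "(d p y')\<^sup>2 \<le> s\<^sup>2 * (d p y)\<^sup>2 + \<delta>" "d p y' \<le> d p y + \<delta>"
    "\<forall>w\<in>M. d p w \<le> R \<longrightarrow>
       (1 - s) * (d p w)\<^sup>2 + s * (d y w)\<^sup>2 - s * (1 - s) * (d p y)\<^sup>2 - \<delta> \<le> (d y' w)\<^sup>2"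
    using approx_point_on_side[OF pts(1,3) s \<delta>] by metis
  obtain z' where z': "z' \<in> M" "(d p z')\<^sup>2 \<le> t\<^sup>2 * (d p z)\<^sup>2 + \<delta>" "d p z' \<le> d p z + \<delta>"
    "\<forall>w\<in>M. d p w \<le> R \<longrightarrow>
       (1 - t) * (d p w)\<^sup>2 + t * (d z w)\<^sup>2 - t * (1 - t) * (d p z)\<^sup>2 - \<delta> \<le> (d z' w)\<^sup>2"
    using approx_point_on_side[OF pts(1,4) t \<delta>] by metis
  have R': "d p x' \<le> R" "d p y' \<le> R" "d p z' \<le> R"
    using x'(3) y'(3) z'(3) R by linarith+
  define A where "A = r * s * ((d p x)\<^sup>2 + (d p y)\<^sup>2 - (d x y)\<^sup>2)"
  define B where "B = s * t * ((d p y)\<^sup>2 + (d p z)\<^sup>2 - (d y z)\<^sup>2)"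
  define C where "C = t * r * ((d p z)\<^sup>2 + (d p x)\<^sup>2 - (d z x)\<^sup>2)"
  note xy = shrunk_pair_distance[OF pts(1,2,3) x'(1) y'(1) r s \<delta> R(1) R'(2) x'(4) y'(4)]
  note yz = shrunk_pair_distance[OF pts(1,3,4) y'(1) z'(1) s t \<delta> R(2) R'(3) y'(4) z'(4)]
  note zx = shrunk_pair_distance[OF pts(1,4,2) z'(1) x'(1) t r \<delta> R(3) R'(1) z'(4) x'(4)]
  show "0 \<le> r\<^sup>2 * (d p x)\<^sup>2 + s\<^sup>2 * (d p y)\<^sup>2 + t\<^sup>2 * (d p z)\<^sup>2
    + r * s * ((d p x)\<^sup>2 + (d p y)\<^sup>2 - (d x y)\<^sup>2) + s * t * ((d p y)\<^sup>2 + (d p z)\<^sup>2 - (d y z)\<^sup>2)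
    + t * r * ((d p z)\<^sup>2 + (d p x)\<^sup>2 - (d z x)\<^sup>2) + \<epsilon>"
    using xy yz zx quadruple[OF pts(1) x'(1) y'(1) z'(1)] x'(2) y'(2) z'(2)
    unfolding A_def[symmetric] B_def[symmetric] C_def[symmetric] \<delta>_def by linarith
qed

text \<open>The form is homogeneous of degree 2 in the weights, so dividing them by their sum
  reduces to weights at most 1.\<close>

lemma weighted_quadruple:
  assumes pts: "p \<in> M" "x \<in> M" "y \<in> M" "z \<in> M"
    and rst: "0 < r" "0 < s" "0 < t"
  shows "0 \<le> r\<^sup>2 * (d p x)\<^sup>2 + s\<^sup>2 * (d p y)\<^sup>2 + t\<^sup>2 * (d p z)\<^sup>2
    + r * s * ((d p x)\<^sup>2 + (d p y)\<^sup>2 - (d x y)\<^sup>2) + s * t * ((d p y)\<^sup>2 + (d p z)\<^sup>2 - (d y z)\<^sup>2)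
    + t * r * ((d p z)\<^sup>2 + (d p x)\<^sup>2 - (d z x)\<^sup>2)" (is "0 \<le> ?Q")
proof -
  define k where "k = r + s + t"
  have k: "0 < k" using rst by (simp add: k_def)
  have "0 \<le> (r / k)\<^sup>2 * (d p x)\<^sup>2 + (s / k)\<^sup>2 * (d p y)\<^sup>2 + (t / k)\<^sup>2 * (d p z)\<^sup>2
    + (r / k) * (s / k) * ((d p x)\<^sup>2 + (d p y)\<^sup>2 - (d x y)\<^sup>2)
    + (s / k) * (t / k) * ((d p y)\<^sup>2 + (d p z)\<^sup>2 - (d y z)\<^sup>2)
    + (t / k) * (r / k) * ((d p z)\<^sup>2 + (d p x)\<^sup>2 - (d z x)\<^sup>2)"
    using rst by (intro weighted_quadruple_le_1[OF pts]) (auto simp: k_def)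
  also have "\<dots> = ?Q / k\<^sup>2"
    by (simp add: power_divide power2_eq_square add_divide_distrib)
  finally show ?thesis using k by (simp add: zero_le_divide_iff)
qed

end

section \<open>Intrinsic metrics and model angles\<close>

text \<open>Along an almost shortest curve from \<open>x\<close> to \<open>y\<close>, the
  intermediate value theorem finds a point at the exact distance from \<open>x\<close>; the length
  of the curve bounds its distance to \<open>y\<close>.\<close>

lemma intrinsic_metric_approx_point:
  assumes X: "intrinsic_metric X" and x: "x \<in> mspace X" and y: "y \<in> mspace X"
    and s: "0 \<le> s" "s \<le> 1" and e: "0 < e"
  shows "\<exists>m\<in>mspace X. mdist X x m = s * mdist X x y \<and> mdist X m y \<le> (1 - s) * mdist X x y + e"
proof -
  interpret Metric_space "mspace X" "mdist X" by simp
  let ?P = "{g. pathin (mtopology_of X) g \<and> g 0 = x \<and> g 1 = y}"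
  have "(INF g \<in> ?P. curve_length X g) = ennreal (mdist X x y)"
    using X x y by (simp add: intrinsic_metric_def)
  also have "\<dots> < ennreal (mdist X x y + e)"
    using e by (simp add: ennreal_less_iff)
  finally obtain g where g: "pathin (mtopology_of X) g" "g 0 = x" "g 1 = y"
    "curve_length X g < ennreal (mdist X x y + e)"
    by (auto simp: INF_less_iff)
  have cont: "continuous_map (top_of_set {0..1}) (mtopology_of X) g"
    using g(1) by (simp add: pathin_def)
  then have gM: "g u \<in> mspace X" if "u \<in> {0..1}" for u
    using that by (auto simp: continuous_map_def)
  have "continuous_map (top_of_set {0..1}) euclidean (\<lambda>u. mdist X x (g u))"
    using cont x by (intro continuous_map_mdist) auto
  then have "continuous_on {0..1} (\<lambda>u. mdist X x (g u))"
    by simp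
  moreover have "mdist X x (g 0) \<le> s * mdist X x y" "s * mdist X x y \<le> mdist X x (g 1)"
    using x y g s mult_right_mono[of s 1 "mdist X x y"] by auto
  ultimately obtain u where u: "u \<in> {0..1}" "mdist X x (g u) = s * mdist X x y"
    using IVT'[of "\<lambda>u. mdist X x (g u)" 0 "s * mdist X x y" 1] by auto
  \<comment> \<open>The partition 0, \<open>u\<close>, 1 with \<open>n\<close> = 2; \<open>u\<close>
    may be an endpoint, since partitions need not be strictly increasing.\<close>
  define \<tau> :: "nat \<Rightarrow> real" where "\<tau> = (\<lambda>i. if i = 0 then 0 else if i = 1 then u else 1)"
  have "ennreal (\<Sum>i<2. mdist X (g (\<tau> i)) (g (\<tau> (Suc i)))) \<le> curve_length X g"
    unfolding curve_length_def
    by (rule SUP_upper2[of "(2, \<tau>)"]) (use u in \<open>auto simp: \<tau>_def mono_on_def\<close>)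
  also have "(\<Sum>i<2. mdist X (g (\<tau> i)) (g (\<tau> (Suc i)))) = mdist X x (g u) + mdist X (g u) y"
    by (simp add: \<tau>_def g numeral_2_eq_2)
  also note g(4)
  finally have "mdist X x (g u) + mdist X (g u) y < mdist X x y + e"
    by (subst (asm) ennreal_less_iff) auto
  then show ?thesis
    using u gM by (intro bexI[of _ "g u"]) (auto simp: algebra_simps)
qed

text \<open>The triangle inequalities place the argument of \<open>arccos\<close> in [-1, 1], where
  cosine inverts it.\<close>

lemma cos_model_angle:
  assumes pts: "p \<in> mspace X" "x \<in> mspace X" "y \<in> mspace X" and ne: "p \<noteq> x" "p \<noteq> y"
  shows "0 \<le> model_angle X p x y" "model_angle X p x y \<le> pi"
    "2 * mdist X p x * mdist X p y * cos (model_angle X p x y)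
       = (mdist X p x)\<^sup>2 + (mdist X p y)\<^sup>2 - (mdist X x y)\<^sup>2"
proof -
  interpret Metric_space "mspace X" "mdist X" by simp
  let ?a = "mdist X p x" and ?b = "mdist X p y" and ?c = "mdist X x y"
  have pos: "0 < ?a" "0 < ?b" using pts ne by (auto simp: mdist_pos_eq)
  have "?c\<^sup>2 \<le> (?a + ?b)\<^sup>2"
    using triangle[of x p y] pts by (intro power_mono) (auto simp: commute)
  moreover have "\<bar>?a - ?b\<bar>\<^sup>2 \<le> ?c\<^sup>2"
    using triangle[of p x y] triangle[of p y x] pts by (intro power_mono) (auto simp: commute)
  ultimately have "\<bar>?a\<^sup>2 + ?b\<^sup>2 - ?c\<^sup>2\<bar> \<le> 2 * ?a * ?b"
    by (simp add: power2_eq_square algebra_simps abs_le_iff)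
  then have "\<bar>(?a\<^sup>2 + ?b\<^sup>2 - ?c\<^sup>2) / (2 * ?a * ?b)\<bar> \<le> 1"
    using pos by (simp add: field_simps)
  then have r: "- 1 \<le> (?a\<^sup>2 + ?b\<^sup>2 - ?c\<^sup>2) / (2 * ?a * ?b)"
    "(?a\<^sup>2 + ?b\<^sup>2 - ?c\<^sup>2) / (2 * ?a * ?b) \<le> 1"
    by linarith+
  show "0 \<le> model_angle X p x y" "model_angle X p x y \<le> pi"
    unfolding model_angle_def using r by (auto intro: arccos_lbound arccos_ubound)
  show "2 * ?a * ?b * cos (model_angle X p x y) = ?a\<^sup>2 + ?b\<^sup>2 - ?c\<^sup>2"
    unfolding model_angle_def cos_arccos[OF r] using pos by simp
qed

text \<open>The degenerate quadruples with \<open>x\<close> = \<open>p\<close>, about which the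
  angle condition says nothing; they follow from (b + c)^2 \<le> 2 b^2 + 2 c^2.\<close>

lemma (in Metric_space) quadruple_ineq_vertex:
  assumes "p \<in> M" "y \<in> M" "z \<in> M"
  shows "(d p y)\<^sup>2 + (d y z)\<^sup>2 + (d p z)\<^sup>2 \<le> 3 * (d p y)\<^sup>2 + 3 * (d p z)\<^sup>2"
proof -
  have "(d y z)\<^sup>2 \<le> (d p y + d p z)\<^sup>2"
    using triangle[of y p z] assms by (intro power_mono) (auto simp: commute)
  moreover have "0 \<le> (d p y - d p z)\<^sup>2" by simp
  ultimately show ?thesis by (simp add: power2_eq_square algebra_simps)
qed

text \<open>With the distances from \<open>p\<close> as weights, the law of cosines turns the form
  of \<open>weighted_cos_sum_nonneg\<close> into the difference of the two sides.\<close>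

lemma quadruple_ineq_if_angle_sum_le:
  assumes pts: "p \<in> mspace X" "x \<in> mspace X" "y \<in> mspace X" "z \<in> mspace X"
    and angles: "p \<notin> {x, y, z} \<Longrightarrow>
      model_angle X p x y + model_angle X p y z + model_angle X p z x \<le> 2 * pi"
  shows "(mdist X x y)\<^sup>2 + (mdist X y z)\<^sup>2 + (mdist X z x)\<^sup>2
    \<le> 3 * (mdist X p x)\<^sup>2 + 3 * (mdist X p y)\<^sup>2 + 3 * (mdist X p z)\<^sup>2"
proof (cases "p \<in> {x, y, z}")
  case True
  interpret Metric_space "mspace X" "mdist X" by simp
  from True show ?thesis
    using quadruple_ineq_vertex[of p y z] quadruple_ineq_vertex[of p z x]
      quadruple_ineq_vertex[of p x y] pts
    by (auto simp: commute)
next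
  case False
  then have ne: "p \<noteq> x" "p \<noteq> y" "p \<noteq> z" by auto
  note xy = cos_model_angle[OF pts(1,2,3) ne(1,2)]
  note yz = cos_model_angle[OF pts(1,3,4) ne(2,3)]
  note zx = cos_model_angle[OF pts(1,4,2) ne(3,1)]
  show ?thesis
    using weighted_cos_sum_nonneg[OF _ _ _ xy(1,2) yz(1,2) zx(1,2) angles[OF False],
        of "mdist X p x" "mdist X p y" "mdist X p z"]
    unfolding xy(3) yz(3) zx(3) by simp
qed

text \<open>Ratios such as \<open>a / mdist X p x\<close> rescale the distances from
  \<open>p\<close> to arbitrary positive \<open>a\<close>, \<open>b\<close>, \<open>c\<close> while
  keeping the model angles, which is the copositivity that bounds the angle sum.\<close>

lemma angle_sum_le_if_quadruple_ineq:
  assumes X: "intrinsic_metric X"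
    and quad: "\<And>p x y z. p \<in> mspace X \<Longrightarrow> x \<in> mspace X \<Longrightarrow> y \<in> mspace X \<Longrightarrow> z \<in> mspace X \<Longrightarrow>
      (mdist X x y)\<^sup>2 + (mdist X y z)\<^sup>2 + (mdist X z x)\<^sup>2
        \<le> 3 * (mdist X p x)\<^sup>2 + 3 * (mdist X p y)\<^sup>2 + 3 * (mdist X p z)\<^sup>2"
    and pts: "p \<in> mspace X" "x \<in> mspace X" "y \<in> mspace X" "z \<in> mspace X"
    and "p \<notin> {x, y, z}"
  shows "model_angle X p x y + model_angle X p y z + model_angle X p z x \<le> 2 * pi"
proof -
  interpret Metric_space "mspace X" "mdist X" by simp
  interpret quadruple_length_space "mspace X" "mdist X"
    by unfold_locales (use intrinsic_metric_approx_point[OF X] quad in auto)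
  have ne: "p \<noteq> x" "p \<noteq> y" "p \<noteq> z" using \<open>p \<notin> {x, y, z}\<close> by auto
  have pos: "0 < mdist X p x" "0 < mdist X p y" "0 < mdist X p z"
    using pts ne by (auto simp: mdist_pos_eq)
  note xy = cos_model_angle[OF pts(1,2,3) ne(1,2)]
  note yz = cos_model_angle[OF pts(1,3,4) ne(2,3)]
  note zx = cos_model_angle[OF pts(1,4,2) ne(3,1)]
  show ?thesis
  proof (rule angle_sum_le_2pi_if_copositive[OF xy(1,2) yz(1,2) zx(1,2)])
    fix a b c :: real assume abc: "0 < a" "0 < b" "0 < c"
    show "0 \<le> a\<^sup>2 + b\<^sup>2 + c\<^sup>2 + 2 * a * b * cos (model_angle X p x y)
        + 2 * b * c * cos (model_angle X p y z) + 2 * c * a * cos (model_angle X p z x)"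
      using weighted_quadruple[OF pts, of "a / mdist X p x" "b / mdist X p y" "c / mdist X p z"]
        abc pos
      unfolding xy(3)[symmetric] yz(3)[symmetric] zx(3)[symmetric]
      by (simp add: power_divide mult.assoc)
  qed
qed

theorem mainTheorem1:
  fixes X :: "'a metric"
  assumes "mcomplete_of X" and "intrinsic_metric X"
  shows "alexandrov_nonneg_curvature X \<longleftrightarrow>
    (\<forall>p \<in> mspace X. \<forall>x \<in> mspace X. \<forall>y \<in> mspace X. \<forall>z \<in> mspace X.
       (mdist X p x)\<^sup>2 + (mdist X p y)\<^sup>2 + (mdist X p z)\<^sup>2
         \<ge> 1 / 3 * ((mdist X x y)\<^sup>2 + (mdist X y z)\<^sup>2 + (mdist X z x)\<^sup>2))"
    (is "?A \<longleftrightarrow> ?Q")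
proof
  assume A: ?A
  show ?Q
  proof (intro ballI)
    fix p x y z
    assume pts: "p \<in> mspace X" "x \<in> mspace X" "y \<in> mspace X" "z \<in> mspace X"
    then have "p \<notin> {x, y, z} \<Longrightarrow>
        model_angle X p x y + model_angle X p y z + model_angle X p z x \<le> 2 * pi"
      using A unfolding alexandrov_nonneg_curvature_def by blast
    from quadruple_ineq_if_angle_sum_le[OF pts this]
    show "1 / 3 * ((mdist X x y)\<^sup>2 + (mdist X y z)\<^sup>2 + (mdist X z x)\<^sup>2)
        \<le> (mdist X p x)\<^sup>2 + (mdist X p y)\<^sup>2 + (mdist X p z)\<^sup>2"
      by simp
  qed
next
  assume Q: ?Q
  have quad: "(mdist X x y)\<^sup>2 + (mdist X y z)\<^sup>2 + (mdist X z x)\<^sup>2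
      \<le> 3 * (mdist X p x)\<^sup>2 + 3 * (mdist X p y)\<^sup>2 + 3 * (mdist X p z)\<^sup>2"
    if "p \<in> mspace X" "x \<in> mspace X" "y \<in> mspace X" "z \<in> mspace X" for p x y z
  proof -
    have "1 / 3 * ((mdist X x y)\<^sup>2 + (mdist X y z)\<^sup>2 + (mdist X z x)\<^sup>2)
        \<le> (mdist X p x)\<^sup>2 + (mdist X p y)\<^sup>2 + (mdist X p z)\<^sup>2"
      using Q that by blast
    then show ?thesis by simp
  qed
  show ?A
    unfolding alexandrov_nonneg_curvature_def
    using assms angle_sum_le_if_quadruple_ineq[OF assms(2) quad] by blast
qed

end
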